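(* Let $p>1$, $s\in(0,1)$ and let $K$ be a kernel satisfying the assumptions listed in the context. Let $l:\mathbb{H}^N\to\mathbb{R}$ be a Euclidean affine function of the form $l(\xi)=a+b\cdot z+ct$ for $\xi=(z,t)$, where $b\in\mathbb{R}^{2N}$, $a,c\in\mathbb{R}$ and $b\cdot z$ is the Euclidean dot product, and let $0<r<\infty$. Then for every $\xi\in\mathbb{H}^N$ $$\int_{B_r(\xi)\setminus B_\varepsilon(\xi)}|l(\xi)-l(\eta)|^{p-2}(l(\xi)-l(\eta))K(\xi,\eta)\,d\eta=0\qquad\text{for all }0<\varepsilon<r.$$
   Context: $\mathbb{H}^N$ is $\mathbb{R}^{2N+1}$ with points $\xi=(z,t)=(x,y,t)$, $x,y\in\mathbb{R}^N$, $t\in\mathbb{R}$, and group law $\xi\circ\xi'=(x+x',y+y',t+t'+2\langle x',y\rangle-2\langle x,y'\rangle)$; thus $\xi^{-1}=-\xi$. Homogeneous dimension $Q=2N+2$. Homogeneous norm: $|\xi|_{\mathbb{H}^N}=(|z|^4+t^2)^{1/4}$; balls $B_R(\xi_0)=\{\xi:|\xi_0^{-1}\circ\xi|_{\mathbb{H}^N}<R\}$. Integration is with respect to Lebesgue (Haar) measure. Kernel: $0<\lambda\le\Lambda$; $K$ is a positive function defined off the diagonal of $\mathbb{H}^N\times\mathbb{H}^N$ with $\lambda|\eta^{-1}\circ\xi|_{\mathbb{H}^N}^{-Q-sp}\le K(\xi,\eta)\le\Lambda|\eta^{-1}\circ\xi|_{\mathbb{H}^N}^{-Q-sp}$ for $\xi\ne\eta$;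 $K(\xi,\eta)=K(\eta,\xi)$; $K(\xi_0\circ\xi,\xi_0\circ\eta)=K(\xi,\eta)$ for all $\xi_0\in\mathbb{H}^N$; and $\xi\mapsto K(\xi,\eta)$ is continuous away from $\xi=\eta$. *)

theory Defs
  imports "HOL-Analysis.Analysis"
begin

text \<open>
  The Heisenberg group of dimension \<open>2 N + 1\<close>, where \<open>N = CARD('n)\<close>. Points are written
  \<open>((x, y), t)\<close>, so that \<open>z = (x, y)\<close> is the first component; the norm and the inner product
  of the type \<open>(real ^ 'n) \<times> (real ^ 'n)\<close> are the Euclidean ones of the \<open>z\<close>-space, and
  \<^const>\<open>lborel\<close> is the \<open>(2 N + 1)\<close>-dimensional Lebesgue measure.
\<close>

type_synonym 'n heis = "((real ^ 'n) \<times> (real ^ 'n)) \<times> real"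

definition heis_mult :: "'n::finite heis \<Rightarrow> 'n heis \<Rightarrow> 'n heis"  (infixl "\<odot>" 70) where
  "\<xi> \<odot> \<xi>' = (case \<xi> of ((x, y), t) \<Rightarrow> case \<xi>' of ((x', y'), t') \<Rightarrow>
     ((x + x', y + y'), t + t' + 2 * (x' \<bullet> y) - 2 * (x \<bullet> y')))"

text \<open>The inverse for \<^const>\<open>heis_mult\<close> is the componentwise negation of the product type.\<close>

lemma heis_mult_assoc: "(\<xi> \<odot> \<eta>) \<odot> \<zeta> = \<xi> \<odot> (\<eta> \<odot> \<zeta>)"
  by (simp add: heis_mult_def algebra_simps split: prod.split)

lemma heis_mult_0 [simp]: "0 \<odot> \<xi> = \<xi>" "\<xi> \<odot> 0 = \<xi>"
  by (simp_all add: heis_mult_def zero_prod_def split: prod.split)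

lemma heis_mult_inverse [simp]: "(- \<xi>) \<odot> \<xi> = 0" "\<xi> \<odot> (- \<xi>) = 0"
  by (simp_all add: heis_mult_def zero_prod_def inner_commute split: prod.split)

definition heis_norm :: "'n::finite heis \<Rightarrow> real" where
  "heis_norm \<xi> = (norm (fst \<xi>) ^ 4 + (snd \<xi>)\<^sup>2) powr (1 / 4)"

definition heis_ball :: "'n::finite heis \<Rightarrow> real \<Rightarrow> 'n heis set" where
  "heis_ball \<xi>\<^sub>0 R = {\<xi>. heis_norm ((- \<xi>\<^sub>0) \<odot> \<xi>) < R}"

definition heis_hom_dim :: "'n::finite itself \<Rightarrow> real" where
  "heis_hom_dim _ = 2 * real CARD('n) + 2"

text \<open>
  A kernel lives off the diagonal only: every condition is restricted to distinct points, and the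
  values \<open>K \<xi> \<xi>\<close> are unconstrained.
\<close>

definition heis_kernel ::
    "real \<Rightarrow> real \<Rightarrow> real \<Rightarrow> real \<Rightarrow> ('n::finite heis \<Rightarrow> 'n heis \<Rightarrow> real) \<Rightarrow> bool" where
  "heis_kernel p s lam Lam K \<longleftrightarrow>
     (\<forall>\<xi> \<eta>. \<xi> \<noteq> \<eta> \<longrightarrow> K \<xi> \<eta> > 0) \<and>
     (\<forall>\<xi> \<eta>. \<xi> \<noteq> \<eta> \<longrightarrow>
        lam * heis_norm ((- \<eta>) \<odot> \<xi>) powr (- heis_hom_dim TYPE('n) - s * p) \<le> K \<xi> \<eta> \<and>
        K \<xi> \<eta> \<le> Lam * heis_norm ((- \<eta>) \<odot> \<xi>) powr (- heis_hom_dim TYPE('n) - s * p)) \<and>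
     (\<forall>\<xi> \<eta>. \<xi> \<noteq> \<eta> \<longrightarrow> K \<xi> \<eta> = K \<eta> \<xi>) \<and>
     (\<forall>\<xi>\<^sub>0 \<xi> \<eta>. \<xi> \<noteq> \<eta> \<longrightarrow> K (\<xi>\<^sub>0 \<odot> \<xi>) (\<xi>\<^sub>0 \<odot> \<eta>) = K \<xi> \<eta>) \<and>
     (\<forall>\<eta>. continuous_on (- {\<eta>}) (\<lambda>\<xi>. K \<xi> \<eta>))"

end

theory Submission
  imports Defs
begin

text \<open>
  The inversion \<open>\<eta> \<mapsto> \<xi> \<odot> (- (- \<xi> \<odot> \<eta>))\<close> about \<open>\<xi>\<close> is the Euclidean point reflection
  \<open>\<eta> \<mapsto> 2 \<xi> - \<eta>\<close>. It preserves Lebesgue measure, the annulus and, by left invariance and symmetry,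
  \<open>K \<xi>\<close>, while it flips the sign of \<open>l \<xi> - l \<eta>\<close> because \<open>l\<close> is affine. The integral is
  therefore equal to its own negative.
\<close>

text \<open>The twist in the group law is an alternating form, so the pairing of \<xi> with 2 \<xi>
  vanishes and only its pairing with \<eta> survives, with the same sign on both sides.\<close>

lemma heis_mult_reflection: "(- \<xi>) \<odot> (2 *\<^sub>R \<xi> - \<eta>) = - ((- \<xi>) \<odot> \<eta>)"
  by (auto simp: heis_mult_def case_prod_beta prod_eq_iff inner_diff_left inner_diff_right
      inner_commute) (simp_all add: scaleR_2)

lemma heis_mult_cancel: "\<xi> \<odot> ((- \<xi>) \<odot> \<eta>) = \<eta>"
  by (simp flip: heis_mult_assoc)

lemma heis_norm_minus: "heis_norm (- \<xi>) = heis_norm \<xi>"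
  by (simp add: heis_norm_def)

lemma heis_norm_0 [simp]: "heis_norm 0 = 0"
  by (simp add: heis_norm_def)

lemma continuous_on_heis_mult: "continuous_on S ((\<odot>) \<xi>)"
  unfolding heis_mult_def case_prod_beta by (intro continuous_intros)

lemma continuous_on_heis_norm: "continuous_on S heis_norm"
  unfolding heis_norm_def by (intro continuous_on_powr' continuous_intros) auto

text \<open>Closedness comes from continuity of \<open>heis_norm\<close>. For boundedness, the
  anisotropic scaling turns the bound r into |z| \<le> r and |t| \<le> r^2, which gives the
  Euclidean bound r + r^2.\<close>

lemma compact_heis_norm_le: "compact {\<xi> :: 'n::finite heis. heis_norm \<xi> \<le> r}"
proof -
  have "\<exists>B. \<forall>\<xi>\<in>{\<xi> :: 'n heis. heis_norm \<xi> \<le> r}. norm \<xi> \<le> B"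
  proof (intro exI ballI)
    fix \<xi> :: "'n heis" assume "\<xi> \<in> {\<xi>. heis_norm \<xi> \<le> r}"
    moreover have "(heis_norm \<xi>) ^ 4 = norm (fst \<xi>) ^ 4 + (snd \<xi>)\<^sup>2"
      by (simp add: heis_norm_def powr_powr flip: powr_numeral)
    moreover have "0 \<le> heis_norm \<xi>" by (simp add: heis_norm_def)
    ultimately have *: "norm (fst \<xi>) ^ 4 + (snd \<xi>)\<^sup>2 \<le> r ^ 4"
      by (metis mem_Collect_eq power_mono)
    have "0 \<le> r" using \<open>0 \<le> heis_norm \<xi>\<close> \<open>\<xi> \<in> _\<close> by simp
    have "norm (fst \<xi>) ^ 4 \<le> r ^ 4" using * by (smt (verit) zero_le_power2)
    then have "norm (fst \<xi>) \<le> r"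
      using \<open>0 \<le> r\<close> by (simp add: power_mono_iff)
    moreover have "(snd \<xi>)\<^sup>2 \<le> (r\<^sup>2)\<^sup>2"
      using * by (smt (verit) norm_ge_zero power_mult zero_le_power numeral_Bit0 mult_2)
    then have "\<bar>snd \<xi>\<bar> \<le> r\<^sup>2"
      by (metis abs_le_square_iff abs_power2)
    ultimately show "norm \<xi> \<le> r + r\<^sup>2"
      using norm_triangle_ineq[of "(fst \<xi>, 0)" "(0, snd \<xi>)"]
      by (simp add: norm_Pair)
  qed
  moreover have "closed {\<xi> :: 'n heis. heis_norm \<xi> \<le> r}"
    by (intro closed_Collect_le continuous_on_heis_norm continuous_intros)
  ultimately show ?thesis
    by (simp add: compact_eq_bounded_closed bounded_iff)
qed

text \<open>Left translation by \<xi> is continuous and carries the closed annulus about 0 onto this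
  one. Compactness is what later turns continuity of the integrand into integrability.\<close>

lemma compact_heis_annulus:
  "compact {\<eta>. \<epsilon> \<le> heis_norm ((- \<xi>) \<odot> \<eta>) \<and> heis_norm ((- \<xi>) \<odot> \<eta>) \<le> r}"
proof -
  have "compact ({\<eta>. \<epsilon> \<le> heis_norm \<eta>} \<inter> {\<eta>. heis_norm \<eta> \<le> r})"
    by (intro closed_Int_compact compact_heis_norm_le closed_Collect_le continuous_on_heis_norm
        continuous_intros)
  then have "compact ((\<odot>) \<xi> ` ({\<eta>. \<epsilon> \<le> heis_norm \<eta>} \<inter> {\<eta>. heis_norm \<eta> \<le> r}))"
    by (intro compact_continuous_image continuous_on_heis_mult)
  also have "(\<odot>) \<xi> ` ({\<eta>. \<epsilon> \<le> heis_norm \<eta>} \<inter> {\<eta>. heis_norm \<eta> \<le> r}) =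
      {\<eta>. \<epsilon> \<le> heis_norm ((- \<xi>) \<odot> \<eta>) \<and> heis_norm ((- \<xi>) \<odot> \<eta>) \<le> r}"
  proof (intro set_eqI iffI)
    fix \<eta> assume "\<eta> \<in> {\<eta>. \<epsilon> \<le> heis_norm ((- \<xi>) \<odot> \<eta>) \<and> heis_norm ((- \<xi>) \<odot> \<eta>) \<le> r}"
    then show "\<eta> \<in> (\<odot>) \<xi> ` ({\<eta>. \<epsilon> \<le> heis_norm \<eta>} \<inter> {\<eta>. heis_norm \<eta> \<le> r})"
      by (intro image_eqI[of _ _ "(- \<xi>) \<odot> \<eta>"]) (simp_all add: heis_mult_cancel)
  qed (auto simp flip: heis_mult_assoc)
  finally show ?thesis .
qed

lemma borel_heis_ball: "heis_ball \<xi> r \<in> sets borel"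
proof -
  have "open (heis_ball \<xi> r)"
    unfolding heis_ball_def
    by (intro open_Collect_less continuous_on_compose2[OF continuous_on_heis_norm[of UNIV]]
        continuous_on_heis_mult continuous_intros) auto
  then show ?thesis by simp
qed

text \<open>In the coordinate w with \<eta> = \<xi> \<odot> w the reflected point is \<xi> \<odot>
  (- w), so left invariance reduces the claim to K 0 (- w) = K 0 w.\<close>

lemma heis_kernel_reflection:
  assumes "heis_kernel p s lam Lam K" and "\<eta> \<noteq> \<xi>"
  shows "K \<xi> (2 *\<^sub>R \<xi> - \<eta>) = K \<xi> \<eta>"
proof -
  from assms(1) have sym: "\<And>\<xi> \<eta>. \<xi> \<noteq> \<eta> \<Longrightarrow> K \<xi> \<eta> = K \<eta> \<xi>"
    and inv: "\<And>\<zeta> \<xi> \<eta>. \<xi> \<noteq> \<eta> \<Longrightarrow> K (\<zeta> \<odot> \<xi>) (\<zeta> \<odot> \<eta>) = K \<xi> \<eta>"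
    unfolding heis_kernel_def by iprover+
  define w where "w = (- \<xi>) \<odot> \<eta>"
  have "\<eta> = \<xi> \<odot> w" by (simp add: w_def heis_mult_cancel)
  then have "w \<noteq> 0" using assms(2) by auto
  have "2 *\<^sub>R \<xi> - \<eta> = \<xi> \<odot> (- w)"
    by (metis heis_mult_cancel heis_mult_reflection w_def)
  then have "K \<xi> (2 *\<^sub>R \<xi> - \<eta>) = K (\<xi> \<odot> 0) (\<xi> \<odot> (- w))" by simp
  also have "\<dots> = K 0 (- w)" using \<open>w \<noteq> 0\<close> by (intro inv) simp
  \<comment> \<open>Translating by w sends the pair (0, - w) to (w, 0); symmetry then swaps the two
    arguments.\<close>
  also have "\<dots> = K (w \<odot> 0) (w \<odot> (- w))" using \<open>w \<noteq> 0\<close> by (intro inv[symmetric]) simp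
  also have "\<dots> = K 0 w" using sym[of w 0] \<open>w \<noteq> 0\<close> by simp
  also have "\<dots> = K (\<xi> \<odot> 0) (\<xi> \<odot> w)" using \<open>w \<noteq> 0\<close> by (intro inv[symmetric]) simp
  finally show ?thesis using \<open>\<eta> = \<xi> \<odot> w\<close> by simp
qed

text \<open>For p < 2 the factor with exponent p - 2 is singular at zeros of f. The product equals
  the difference of the (p - 1)-th powers of the positive and negative parts of f, and p - 1 > 0
  makes these continuous at 0 too.\<close>

lemma continuous_on_abs_powr_mult:
  fixes f :: "'a::topological_space \<Rightarrow> real"
  assumes "p > 1" and "continuous_on S f"
  shows "continuous_on S (\<lambda>x. \<bar>f x\<bar> powr (p - 2) * f x)"
proof -
  have "\<bar>y\<bar> powr (p - 2) * y = max y 0 powr (p - 1) - max (- y) 0 powr (p - 1)" for y :: real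
    using powr_mult_base[of "\<bar>y\<bar>" "p - 2"] by (cases y "0::real" rule: linorder_cases) (auto simp: mult.commute)
  moreover have "continuous_on S (\<lambda>x. max (f x) 0 powr (p - 1) - max (- f x) 0 powr (p - 1))"
    using assms by (intro continuous_intros continuous_on_powr') auto
  ultimately show ?thesis by simp
qed

text \<open>This is the affine change of variables with factor - 1, whose Jacobian has absolute
  value 1.\<close>

lemma lborel_distr_reflection:
  "distr lborel borel (\<lambda>x. c - x) = (lborel :: 'a::euclidean_space measure)"
  using lborel_affine[of "- 1" c] by (simp add: density_1)

text \<open>Measurability suffices here: the change of variables holds for the Bochner integral of
  any measurable function, a non-integrable one having integral 0 by convention.\<close>

lemma lborel_set_integral_odd_reflection:
  fixes f :: "'a::euclidean_space \<Rightarrow> real"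
  assumes "set_borel_measurable borel A f"
    and "\<And>x. c - x \<in> A \<longleftrightarrow> x \<in> A" and "\<And>x. x \<in> A \<Longrightarrow> f (c - x) = - f x"
  shows "(LINT x:A|lborel. f x) = 0"
proof -
  let ?g = "\<lambda>x. indicator A x *\<^sub>R f x"
  have "integral\<^sup>L lborel ?g = (LINT x|distr lborel borel (\<lambda>x. c - x). ?g x)"
    by (simp add: lborel_distr_reflection)
  also have "\<dots> = (LINT x|lborel. ?g (c - x))"
    using assms(1) by (intro integral_distr) (auto simp: set_borel_measurable_def)
  also have "\<dots> = (LINT x|lborel. - ?g x)"
    using assms(2,3) by (intro Bochner_Integration.integral_cong) (auto simp: indicator_def)
  finally show ?thesis by (simp add: set_lebesgue_integral_def)
qed

text \<open>Integrability is part of the conclusion because the default value 0 for non-integrable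
  functions would otherwise leave open whether the integral really exists.\<close>

theorem lemma2p1:
  fixes p s lam Lam a c r :: real
    and b :: "(real ^ 'n) \<times> (real ^ 'n)"
    and K :: "'n::finite heis \<Rightarrow> 'n heis \<Rightarrow> real"
    and l :: "'n heis \<Rightarrow> real"
  assumes "p > 1" and "0 < s" and "s < 1"
    and "0 < lam" and "lam \<le> Lam"
    and "heis_kernel p s lam Lam K"
    and "\<And>z t. l (z, t) = a + b \<bullet> z + c * t"
    and "0 < r"
  shows "\<forall>\<xi>. \<forall>\<epsilon>. 0 < \<epsilon> \<and> \<epsilon> < r \<longrightarrow>
    set_integrable lborel (heis_ball \<xi> r - heis_ball \<xi> \<epsilon>)
      (\<lambda>\<eta>. \<bar>l \<xi> - l \<eta>\<bar> powr (p - 2) * (l \<xi> - l \<eta>) * K \<xi> \<eta>) \<and>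
    (LINT \<eta>:(heis_ball \<xi> r - heis_ball \<xi> \<epsilon>)|lborel.
      \<bar>l \<xi> - l \<eta>\<bar> powr (p - 2) * (l \<xi> - l \<eta>) * K \<xi> \<eta>) = 0"
proof (intro allI impI)
  fix \<xi> :: "'n heis" and \<epsilon> :: real
  assume \<epsilon>: "0 < \<epsilon> \<and> \<epsilon> < r"
  define A where "A = heis_ball \<xi> r - heis_ball \<xi> \<epsilon>"
  \<comment> \<open>The closed annulus is a compact superset of \<open>A\<close> that still avoids
    the diagonal point \<xi>, since \<epsilon> > 0.\<close>
  define C where "C = {\<eta>. \<epsilon> \<le> heis_norm ((- \<xi>) \<odot> \<eta>) \<and> heis_norm ((- \<xi>) \<odot> \<eta>) \<le> r}"
  define f where "f = (\<lambda>\<eta>. \<bar>l \<xi> - l \<eta>\<bar> powr (p - 2) * (l \<xi> - l \<eta>) * K \<xi> \<eta>)"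
  have l: "l \<eta> = a + b \<bullet> fst \<eta> + c * snd \<eta>" for \<eta>
    using assms(7)[of "fst \<eta>" "snd \<eta>"] by simp
  have "A \<subseteq> C" by (auto simp: A_def C_def heis_ball_def)
  have "\<xi> \<notin> C" using \<epsilon> by (simp add: C_def)
  have "A \<in> sets borel" by (auto simp: A_def borel_heis_ball)
  \<comment> \<open>The kernel is assumed continuous in its first argument, whereas the integration
    runs over the second; symmetry off the diagonal bridges the two.\<close>
  have "continuous_on C (\<lambda>\<eta>. K \<eta> \<xi>)"
    using assms(6) \<open>\<xi> \<notin> C\<close> continuous_on_subset[of "- {\<xi>}" _ C] unfolding heis_kernel_def by blast
  moreover have "K \<eta> \<xi> = K \<xi> \<eta>" if "\<eta> \<in> C" for \<eta>
    using assms(6) \<open>\<xi> \<notin> C\<close> that unfolding heis_kernel_def by metis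
  ultimately have "continuous_on C (K \<xi>)"
    by (simp cong: continuous_on_cong)
  then have "continuous_on C f"
    unfolding f_def l using assms(1)
    by (intro continuous_on_mult[of C _ "K \<xi>"] continuous_on_abs_powr_mult continuous_intros)
  then have "set_integrable lborel C f"
    unfolding set_integrable_def
    by (intro borel_integrable_compact) (simp_all add: C_def compact_heis_annulus)
  then have int: "set_integrable lborel A f"
    by (rule set_integrable_subset) (use \<open>A \<subseteq> C\<close> \<open>A \<in> sets borel\<close> in auto)
  have "(LINT \<eta>:A|lborel. f \<eta>) = 0"
  proof (rule lborel_set_integral_odd_reflection[where c = "2 *\<^sub>R \<xi>"])
    \<comment> \<open>Integrability of the indicator of \<open>A\<close> times \<open>f\<close>
      already contains its Borel measurability.\<close>
    show "set_borel_measurable borel A f"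
      using int by (simp add: set_integrable_def set_borel_measurable_def integrable_iff_bounded)
    show "2 *\<^sub>R \<xi> - \<eta> \<in> A \<longleftrightarrow> \<eta> \<in> A" for \<eta>
      by (simp add: A_def heis_ball_def heis_mult_reflection heis_norm_minus)
    show "f (2 *\<^sub>R \<xi> - \<eta>) = - f \<eta>" if "\<eta> \<in> A" for \<eta>
    proof -
      have "\<eta> \<noteq> \<xi>" using that \<open>A \<subseteq> C\<close> \<open>\<xi> \<notin> C\<close> by auto
      have eq: "l \<xi> - l (2 *\<^sub>R \<xi> - \<eta>) = - (l \<xi> - l \<eta>)"
        by (simp add: l inner_diff_right algebra_simps)
      show ?thesis
        unfolding f_def eq heis_kernel_reflection[OF assms(6) \<open>\<eta> \<noteq> \<xi>\<close>]
        by (simp only: abs_minus_cancel mult_minus_left mult_minus_right)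
    qed
  qed
  with int show "set_integrable lborel (heis_ball \<xi> r - heis_ball \<xi> \<epsilon>)
      (\<lambda>\<eta>. \<bar>l \<xi> - l \<eta>\<bar> powr (p - 2) * (l \<xi> - l \<eta>) * K \<xi> \<eta>) \<and>
    (LINT \<eta>:(heis_ball \<xi> r - heis_ball \<xi> \<epsilon>)|lborel.
      \<bar>l \<xi> - l \<eta>\<bar> powr (p - 2) * (l \<xi> - l \<eta>) * K \<xi> \<eta>) = 0"
    by (simp add: A_def f_def)
qed

end
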